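(* Let $M \ge 1$ be an integer, let $\rho_0, \rho_1, \dots, \rho_{M-1} \in \mathbb{R}$, and let $\Sigma \in \mathbb{R}^{M\times M}$ be the symmetric Toeplitz matrix with entries $\Sigma_{ij} = \rho_{|i-j|}$. Let $C_\Sigma$ be the real circulant matrix with first row $(c_0, c_1, \dots, c_{M-1})$ given by $$c_0 = \rho_0, \qquad c_m = \rho_m + \frac{m}{M}\left(\rho_{M-m} - \rho_m\right) \quad \text{for } 1 \le m \le M-1.$$ Then $C_\Sigma$ is the unique minimizer of $\|\Sigma - C\|_F$ over all real circulant matrices $C \in \mathbb{R}^{M \times M}$. Moreover, $C_\Sigma$ is a symmetric circulant matrix, i.e. $c_m = c_{M-m}$ for all $1 \le m \le M-1$, and its eigenvalues are $$\lambda_k(C_\Sigma) = \rho_0 + 2\sum_{m=1}^{M-1} \frac{M-m}{M}\, \rho_m \cos\frac{2\pi m k}{M}, \qquad k = 0, 1, \dots, M-1,$$ with corresponding eigenvectors $\mathbf{x}_k = (1, \omega^k, \omega^{2k}, \dots, \omega^{(M-1)k})^{\mathsf{T}}$, where $\omega = e^{2\pi i/M}$.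
   Context: A matrix $C \in \mathbb{C}^{M\times M}$ is circulant with first row $(c_0, c_1, \dots, c_{M-1})$ if each row is the cyclic shift by one position to the right of the previous row; that is, $C_{ij} = c_{(j-i) \bmod M}$. The Frobenius norm of a real matrix $A$ is $\|A\|_F = \sqrt{\operatorname{trace}(A^{\mathsf{T}}A)}$. *)

theory Defs
  imports "Jordan_Normal_Form.Spectral_Radius"
begin

text \<open>Rows and columns are indexed by \<open>0, \<dots>, M - 1\<close>. A sequence \<open>c :: nat \<Rightarrow> 'a\<close> stands for
  the tuple \<open>(c 0, \<dots>, c (M - 1))\<close>; its other values do not matter.\<close>

definition circulant_mat :: "nat \<Rightarrow> (nat \<Rightarrow> 'a) \<Rightarrow> 'a mat" where
  "circulant_mat M c = mat M M (\<lambda>(i, j). c (nat ((int j - int i) mod int M)))"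

definition is_circulant :: "nat \<Rightarrow> 'a mat \<Rightarrow> bool" where
  "is_circulant M C \<longleftrightarrow> (\<exists>c. C = circulant_mat M c)"

definition sym_toeplitz_mat :: "nat \<Rightarrow> (nat \<Rightarrow> 'a) \<Rightarrow> 'a mat" where
  "sym_toeplitz_mat M \<rho> = mat M M (\<lambda>(i, j). \<rho> (nat \<bar>int i - int j\<bar>))"

definition mat_trace :: "'a :: comm_monoid_add mat \<Rightarrow> 'a" where
  "mat_trace A = (\<Sum>i<dim_row A. A $$ (i, i))"

definition frobenius_norm :: "real mat \<Rightarrow> real" where
  "frobenius_norm A = sqrt (mat_trace (transpose_mat A * A))"

definition circ_coeff :: "nat \<Rightarrow> (nat \<Rightarrow> real) \<Rightarrow> nat \<Rightarrow> real" where
  "circ_coeff M \<rho> m =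
     (if m = 0 then \<rho> 0 else \<rho> m + real m / real M * (\<rho> (M - m) - \<rho> m))"

definition circ_eigval :: "nat \<Rightarrow> (nat \<Rightarrow> real) \<Rightarrow> nat \<Rightarrow> real" where
  "circ_eigval M \<rho> k =
     \<rho> 0 + 2 * (\<Sum>m = 1..M - 1. (real M - real m) / real M * \<rho> m
                  * cos (2 * pi * real m * real k / real M))"

definition fourier_vec :: "nat \<Rightarrow> nat \<Rightarrow> complex vec" where
  "fourier_vec M k =
     (let \<omega> = exp (2 * complex_of_real pi * \<i> / of_nat M) in vec M (\<lambda>j. \<omega> ^ (j * k)))"

end

theory Submission
  imports Defs
begin

text \<open>The entries of an \<open>M \<times> M\<close> matrix split into \<open>M\<close> cyclic diagonals
  \<open>{(i, (i + m) mod M) | i < M}\<close>, and a circulant matrix is one that is constant on each of them.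
  So \<open>\<parallel>A - C\<parallel>\<^sup>2\<close> decouples into \<open>M\<close> independent one-variable least-squares problems, each solved
  uniquely by the mean of \<open>A\<close> over the diagonal (\<open>frobenius_norm_minus_circulant\<close>). On the
  \<open>m\<close>-th cyclic diagonal a symmetric Toeplitz matrix takes the value \<open>\<rho> m\<close> at the \<open>M - m\<close> places
  before the wrap-around and \<open>\<rho> (M - m)\<close> at the \<open>m\<close> places after it, so the mean is
  \<open>circ_coeff M \<rho> m\<close> (\<open>sum_toeplitz_cyclic_diagonal\<close>).

  For the spectrum, every circulant matrix with first row \<open>c\<close> is diagonalised by the Fourier
  vectors, the eigenvalues being the discrete Fourier transform of \<open>c\<close>. The Fourier matrix is
  invertible because of the orthogonality of the characters of \<open>\<int>/M\<close>, so the
  characteristic polynomial can be read off (\<open>char_poly_circulant\<close>). For \<open>c = circ_coeff M \<rho>\<close>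
  the two terms of \<open>c m\<close> are exchanged by \<open>m \<mapsto> M - m\<close>, which conjugates the roots of unity; pairing
  them turns the Fourier transform into the stated cosine sum (\<open>dft_circ_coeff\<close>).\<close>

section \<open>Cyclic diagonals\<close>

lemma circulant_mat_carrier [simp]: "circulant_mat M c \<in> carrier_mat M M"
  by (simp add: circulant_mat_def)

lemma dim_circulant_mat [simp]:
  "dim_row (circulant_mat M c) = M" "dim_col (circulant_mat M c) = M"
  by (simp_all add: circulant_mat_def)

lemma index_circulant_mat [simp]:
  "i < M \<Longrightarrow> j < M \<Longrightarrow> circulant_mat M c $$ (i, j) = c (nat ((int j - int i) mod int M))"
  by (simp add: circulant_mat_def)

lemma circulant_mat_cong:
  assumes "\<And>m. m < M \<Longrightarrow> c m = d m"
  shows "circulant_mat M c = circulant_mat M d"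
proof (rule eq_matI)
  fix i j assume ij: "i < dim_row (circulant_mat M d)" "j < dim_col (circulant_mat M d)"
  then have "nat ((int j - int i) mod int M) < M"
    by (simp add: nat_less_iff)
  with ij assms show "circulant_mat M c $$ (i, j) = circulant_mat M d $$ (i, j)"
    by simp
qed simp_all

lemma sum_cyclic_reindex:
  fixes f :: "nat \<Rightarrow> nat \<Rightarrow> 'a :: comm_monoid_add"
  assumes "i < M"
  shows "(\<Sum>j<M. f (nat ((int j - int i) mod int M)) j) = (\<Sum>m<M. f m ((i + m) mod M))"
proof (rule sum.reindex_bij_witness[where j = "\<lambda>j. nat ((int j - int i) mod int M)"
        and i = "\<lambda>m. (i + m) mod M"])
  fix j assume j: "j \<in> {..<M}"
  show "(i + nat ((int j - int i) mod int M)) mod M = j"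
  proof -
    have "int ((i + nat ((int j - int i) mod int M)) mod M) = int j"
      using j assms by (simp add: zmod_int mod_add_right_eq)
    then show ?thesis by linarith
  qed
  then show "f (nat ((int j - int i) mod int M)) ((i + nat ((int j - int i) mod int M)) mod M) =
      f (nat ((int j - int i) mod int M)) j"
    by simp
  show "nat ((int j - int i) mod int M) \<in> {..<M}"
    using assms by (simp add: nat_less_iff)
next
  fix m assume m: "m \<in> {..<M}"
  have "(int ((i + m) mod M) - int i) mod int M = int m"
    using m by (simp add: zmod_int mod_diff_left_eq)
  then show "nat ((int ((i + m) mod M) - int i) mod int M) = m" by simp
  show "(i + m) mod M \<in> {..<M}" using assms by simp
qed

section \<open>The nearest circulant matrix\<close>

lemma frobenius_norm_power2:
  "(frobenius_norm A)\<^sup>2 = (\<Sum>i<dim_row A. \<Sum>j<dim_col A. (A $$ (i, j))\<^sup>2)"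
proof -
  have "mat_trace (transpose_mat A * A) = (\<Sum>j<dim_col A. \<Sum>i<dim_row A. (A $$ (i, j))\<^sup>2)"
    by (simp add: mat_trace_def scalar_prod_def power2_eq_square atLeast0LessThan)
  also have "\<dots> = (\<Sum>i<dim_row A. \<Sum>j<dim_col A. (A $$ (i, j))\<^sup>2)"
    by (rule sum.swap)
  finally show ?thesis
    by (simp add: frobenius_norm_def sum_nonneg)
qed

lemma sum_squares_about_mean:
  fixes x :: "nat \<Rightarrow> real"
  assumes "(\<Sum>i<n. x i) = real n * a"
  shows "(\<Sum>i<n. (x i - c)\<^sup>2) = (\<Sum>i<n. (x i - a)\<^sup>2) + real n * (a - c)\<^sup>2"
proof -
  have "(\<Sum>i<n. (x i - c)\<^sup>2) = (\<Sum>i<n. (x i - a)\<^sup>2 + 2 * (a - c) * x i - 2 * (a - c) * a + (a - c)\<^sup>2)"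
    by (rule sum.cong) (simp_all add: power2_eq_square algebra_simps)
  also have "\<dots> = (\<Sum>i<n. (x i - a)\<^sup>2) + 2 * (a - c) * (\<Sum>i<n. x i) - real n * (2 * (a - c) * a)
      + real n * (a - c)\<^sup>2"
    by (simp add: sum.distrib sum_subtractf sum_distrib_left)
  finally show ?thesis
    using assms by simp
qed

lemma frobenius_norm_minus_circulant_sum:
  assumes "A \<in> carrier_mat M M"
  shows "(frobenius_norm (A - circulant_mat M c))\<^sup>2
       = (\<Sum>m<M. \<Sum>i<M. (A $$ (i, (i + m) mod M) - c m)\<^sup>2)"
proof -
  have "(frobenius_norm (A - circulant_mat M c))\<^sup>2
      = (\<Sum>i<M. \<Sum>j<M. (A $$ (i, j) - c (nat ((int j - int i) mod int M)))\<^sup>2)"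
    using assms by (simp add: frobenius_norm_power2)
  also have "\<dots> = (\<Sum>i<M. \<Sum>m<M. (A $$ (i, (i + m) mod M) - c m)\<^sup>2)"
    by (intro sum.cong refl sum_cyclic_reindex) simp
  also have "\<dots> = (\<Sum>m<M. \<Sum>i<M. (A $$ (i, (i + m) mod M) - c m)\<^sup>2)"
    by (rule sum.swap)
  finally show ?thesis .
qed

text \<open>Pythagoras for the orthogonal projection onto the circulant matrices: the projection
  replaces each entry by the mean over its cyclic diagonal.\<close>

lemma frobenius_norm_minus_circulant:
  assumes "A \<in> carrier_mat M M"
    and "\<And>m. m < M \<Longrightarrow> (\<Sum>i<M. A $$ (i, (i + m) mod M)) = real M * a m"
  shows "(frobenius_norm (A - circulant_mat M c))\<^sup>2
       = (frobenius_norm (A - circulant_mat M a))\<^sup>2 + real M * (\<Sum>m<M. (a m - c m)\<^sup>2)"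
proof -
  have "(\<Sum>m<M. \<Sum>i<M. (A $$ (i, (i + m) mod M) - c m)\<^sup>2)
      = (\<Sum>m<M. (\<Sum>i<M. (A $$ (i, (i + m) mod M) - a m)\<^sup>2) + real M * (a m - c m)\<^sup>2)"
    by (intro sum.cong refl sum_squares_about_mean assms(2)) simp
  then show ?thesis
    by (simp add: frobenius_norm_minus_circulant_sum[OF assms(1)] sum.distrib sum_distrib_left)
qed

lemma is_arg_min_circulant_iff:
  assumes A: "A \<in> carrier_mat M M"
    and mean: "\<And>m. m < M \<Longrightarrow> (\<Sum>i<M. A $$ (i, (i + m) mod M)) = real M * a m"
  shows "is_arg_min (\<lambda>C. frobenius_norm (A - C)) (is_circulant M) C \<longleftrightarrow> C = circulant_mat M a"
proof -
  let ?f = "\<lambda>C. frobenius_norm (A - C)"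
  have nonneg: "0 \<le> ?f D" for D
    by (simp add: frobenius_norm_def mat_trace_def scalar_prod_def sum_nonneg)
  have pythagoras: "(?f (circulant_mat M c))\<^sup>2
      = (?f (circulant_mat M a))\<^sup>2 + real M * (\<Sum>m<M. (a m - c m)\<^sup>2)" for c
    by (rule frobenius_norm_minus_circulant[OF A]) (rule mean)
  have le: "?f (circulant_mat M a) \<le> ?f (circulant_mat M c)" for c
  proof (rule power2_le_imp_le[OF _ nonneg])
    show "(?f (circulant_mat M a))\<^sup>2 \<le> (?f (circulant_mat M c))\<^sup>2"
      using pythagoras[of c] by (simp add: sum_nonneg)
  qed
  have eq: "circulant_mat M c = circulant_mat M a"
    if "?f (circulant_mat M c) \<le> ?f (circulant_mat M a)" for c
  proof (rule circulant_mat_cong)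
    fix m assume m: "m < M"
    from that le[of c] have "?f (circulant_mat M c) = ?f (circulant_mat M a)"
      by (rule antisym)
    with pythagoras[of c]
    have "real M * (\<Sum>m<M. (a m - c m)\<^sup>2) = 0"
      by simp
    with m have "(\<Sum>m<M. (a m - c m)\<^sup>2) = 0"
      by simp
    then have "\<forall>m\<in>{..<M}. (a m - c m)\<^sup>2 = 0"
      by (subst (asm) sum_nonneg_eq_0_iff) auto
    with m show "c m = a m" by simp
  qed
  show ?thesis
    using le eq by (auto simp: is_arg_min_def is_circulant_def not_less)
qed

text \<open>A convex combination of \<open>\<rho> m\<close> and \<open>\<rho> (M - m)\<close>; at \<open>m = 0\<close> the out-of-range value \<open>\<rho> M\<close>
  enters with weight \<open>0\<close>.\<close>

lemma circ_coeff_weighted: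
  "m < M \<Longrightarrow> circ_coeff M \<rho> m = (real M - real m) / real M * \<rho> m + real m / real M * \<rho> (M - m)"
  by (auto simp: circ_coeff_def field_simps)

lemma sum_toeplitz_cyclic_diagonal:
  assumes m: "m < M"
  shows "(\<Sum>i<M. sym_toeplitz_mat M \<rho> $$ (i, (i + m) mod M)) = real M * circ_coeff M \<rho> m"
proof -
  have "(\<Sum>i<M. sym_toeplitz_mat M \<rho> $$ (i, (i + m) mod M))
      = (\<Sum>i<M. if i < M - m then \<rho> m else \<rho> (M - m))"
  proof (rule sum.cong[OF refl])
    fix i assume "i \<in> {..<M}"
    then have i: "i < M" by simp
    show "sym_toeplitz_mat M \<rho> $$ (i, (i + m) mod M) = (if i < M - m then \<rho> m else \<rho> (M - m))"
    proof (cases "i < M - m")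
      case True
      then have "(i + m) mod M = i + m" by simp
      with True i show ?thesis by (simp add: sym_toeplitz_mat_def)
    next
      case False
      with i m have mod: "(i + m) mod M = i + m - M"
        by (simp add: le_mod_geq)
      from False i m have "nat \<bar>int i - int (i + m - M)\<bar> = M - m" by linarith
      with False mod i m show ?thesis
        by (simp add: sym_toeplitz_mat_def del: of_nat_diff)
    qed
  qed
  also have "\<dots> = (\<Sum>i<M - m. \<rho> m) + (\<Sum>i\<in>{M - m..<M}. \<rho> (M - m))"
  proof -
    have "{..<M} \<inter> {i. i < M - m} = {..<M - m}" "{..<M} \<inter> - {i. i < M - m} = {M - m..<M}"
      by auto
    then show ?thesis
      by (simp add: sum.If_cases)
  qed
  also have "\<dots> = real M * circ_coeff M \<rho> m"
    using m by (simp add: circ_coeff_weighted of_nat_diff field_simps)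
  finally show ?thesis .
qed

section \<open>Symmetry\<close>

lemma circ_coeff_reflect:
  assumes "0 < m" "m < M"
  shows "circ_coeff M \<rho> m = circ_coeff M \<rho> (M - m)"
  using assms by (simp add: circ_coeff_weighted of_nat_diff)

lemma transpose_circulant_mat:
  assumes c: "\<And>m. 0 < m \<Longrightarrow> m < M \<Longrightarrow> c m = c (M - m)"
  shows "transpose_mat (circulant_mat M c) = circulant_mat M c"
proof (rule eq_matI)
  fix i j assume "i < dim_row (circulant_mat M c)" "j < dim_col (circulant_mat M c)"
  then have i: "i < M" and j: "j < M" by simp_all
  define m where "m = nat ((int j - int i) mod int M)"
  have m: "int m = (int j - int i) mod int M" and "m < M"
    using i by (simp_all add: m_def nat_less_iff)
  have neg: "(int i - int j) mod int M = (if m = 0 then 0 else int M - int m)"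
    using zmod_zminus1_eq_if[of "int j - int i" "int M"] m by auto
  have "c (nat ((int i - int j) mod int M)) = c m"
  proof (cases "m = 0")
    case False
    then have "nat ((int i - int j) mod int M) = M - m"
      using neg \<open>m < M\<close> by simp
    with False \<open>m < M\<close> c[of m] show ?thesis by simp
  qed (simp add: neg)
  with i j show "transpose_mat (circulant_mat M c) $$ (i, j) = circulant_mat M c $$ (i, j)"
    by (simp add: m_def)
qed simp_all

section \<open>Diagonalisation by the Fourier matrix\<close>

definition unity_root :: "nat \<Rightarrow> complex" where
  "unity_root M = cis (2 * pi / real M)"

definition dft :: "nat \<Rightarrow> (nat \<Rightarrow> complex) \<Rightarrow> nat \<Rightarrow> complex" where
  "dft M c k = (\<Sum>m<M. c m * unity_root M ^ (m * k))"

lemma unity_root_power: "unity_root M ^ n = cis (2 * pi * real n / real M)"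
  by (simp add: unity_root_def DeMoivre field_simps)

lemma unity_root_power_M: "M > 0 \<Longrightarrow> unity_root M ^ M = 1"
  by (simp add: unity_root_power)

lemma unity_root_power_mod: "M > 0 \<Longrightarrow> unity_root M ^ (n mod M * k) = unity_root M ^ (n * k)"
proof -
  assume "M > 0"
  have "unity_root M ^ (n * k) = unity_root M ^ ((n mod M + M * (n div M)) * k)"
    by simp
  also have "\<dots> = unity_root M ^ (n mod M * k) * (unity_root M ^ M) ^ (n div M * k)"
    by (simp only: distrib_right power_add power_mult mult.assoc)
  finally show ?thesis
    using \<open>M > 0\<close> by (simp add: unity_root_power_M)
qed

lemma unity_root_power_inj:
  assumes "i < M" "j < M" "unity_root M ^ i = unity_root M ^ j"
  shows "i = j"
proof -
  have "inj_on (\<lambda>k. cis (2 * pi * real k / real M)) {..<M}"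
    using bij_betw_roots_unity[of M] assms(1) by (auto simp: bij_betw_def)
  with assms show ?thesis
    by (auto simp: unity_root_power dest: inj_onD)
qed

lemma fourier_vec_eq: "fourier_vec M k = vec M (\<lambda>j. unity_root M ^ (j * k))"
proof -
  have "exp (2 * complex_of_real pi * \<i> / of_nat M) = unity_root M"
    by (simp add: unity_root_def cis_conv_exp mult_ac)
  then show ?thesis
    by (simp add: fourier_vec_def Let_def)
qed

text \<open>Row \<open>i\<close> of a circulant matrix is the first row shifted by \<open>i\<close>, and shifting the index of a
  character only multiplies it by its value at \<open>i\<close>.\<close>

lemma circulant_mult_fourier_vec:
  "circulant_mat M c *\<^sub>v fourier_vec M k = dft M c k \<cdot>\<^sub>v fourier_vec M k"
proof (rule eq_vecI)
  fix i assume "i < dim_vec (dft M c k \<cdot>\<^sub>v fourier_vec M k)"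
  then have i: "i < M" by (simp add: fourier_vec_eq)
  have "(circulant_mat M c *\<^sub>v fourier_vec M k) $ i
      = (\<Sum>j<M. c (nat ((int j - int i) mod int M)) * unity_root M ^ (j * k))"
    using i by (simp add: scalar_prod_def fourier_vec_eq atLeast0LessThan)
  also have "\<dots> = (\<Sum>m<M. c m * unity_root M ^ ((i + m) mod M * k))"
    by (rule sum_cyclic_reindex[OF i])
  also have "\<dots> = (\<Sum>m<M. c m * unity_root M ^ (m * k)) * unity_root M ^ (i * k)"
    using i by (simp add: unity_root_power_mod distrib_right power_add sum_distrib_right
        mult.assoc mult.commute[of "unity_root M ^ (i * k)"])
  finally show "(circulant_mat M c *\<^sub>v fourier_vec M k) $ i = (dft M c k \<cdot>\<^sub>v fourier_vec M k) $ i"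
    using i by (simp add: fourier_vec_eq dft_def)
qed (simp add: fourier_vec_eq)

lemma eigenvector_circulant:
  assumes "M > 0"
  shows "eigenvector (circulant_mat M c) (fourier_vec M k) (dft M c k)"
proof -
  have "fourier_vec M k $ 0 = 1" "(0\<^sub>v M :: complex vec) $ 0 = 0"
    using assms by (simp_all add: fourier_vec_eq)
  then have "fourier_vec M k \<noteq> 0\<^sub>v M"
    by auto
  then show ?thesis
    unfolding eigenvector_def
    using circulant_mult_fourier_vec[of M c k] by (simp add: fourier_vec_eq)
qed

definition fourier_mat :: "nat \<Rightarrow> complex mat" where
  "fourier_mat M = mat M M (\<lambda>(j, k). unity_root M ^ (j * k))"

lemma sum_unity_root_orthogonal:
  assumes i: "i < M" and j: "j < M"
  shows "(\<Sum>k<M. unity_root M ^ (i * k) * inverse (unity_root M ^ (j * k)))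
       = (if i = j then of_nat M else 0)"
proof -
  have nz: "unity_root M \<noteq> 0" by (simp add: unity_root_def)
  define z where "z = unity_root M ^ i * inverse (unity_root M ^ j)"
  have "(\<Sum>k<M. unity_root M ^ (i * k) * inverse (unity_root M ^ (j * k))) = (\<Sum>k<M. z ^ k)"
    by (simp add: z_def power_mult power_mult_distrib power_inverse)
  also have "\<dots> = (if i = j then of_nat M else 0)"
  proof (cases "i = j")
    case True
    then show ?thesis using nz by (simp add: z_def)
  next
    case False
    then have "unity_root M ^ i \<noteq> unity_root M ^ j"
      using unity_root_power_inj i j by blast
    then have "z \<noteq> 1"
      using nz by (simp add: z_def field_simps)
    moreover have "z ^ M = (unity_root M ^ M) ^ i * inverse ((unity_root M ^ M) ^ j)"
      by (simp add: z_def power_mult_distrib power_inverse mult.commute flip: power_mult)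
    then have "z ^ M = 1"
      using i by (simp add: unity_root_power_M)
    ultimately show ?thesis
      using False by (simp add: geometric_sum)
  qed
  finally show ?thesis .
qed

lemma fourier_mat_inverse:
  assumes "M > 0"
  defines "G \<equiv> mat M M (\<lambda>(k, j). inverse (unity_root M ^ (j * k)) / of_nat M)"
  shows "fourier_mat M * G = 1\<^sub>m M" "G * fourier_mat M = 1\<^sub>m M"
proof -
  show right: "fourier_mat M * G = 1\<^sub>m M"
  proof (rule eq_matI)
    fix i j assume "i < dim_row (1\<^sub>m M :: complex mat)" "j < dim_col (1\<^sub>m M :: complex mat)"
    then have ij: "i < M" "j < M" by simp_all
    then have "(fourier_mat M * G) $$ (i, j)
        = (\<Sum>k<M. unity_root M ^ (i * k) * inverse (unity_root M ^ (j * k))) / of_nat M"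
      by (simp add: fourier_mat_def G_def scalar_prod_def atLeast0LessThan sum_divide_distrib)
    with ij show "(fourier_mat M * G) $$ (i, j) = 1\<^sub>m M $$ (i, j)"
      using assms by (simp add: sum_unity_root_orthogonal)
  qed (simp_all add: fourier_mat_def G_def)
  show "G * fourier_mat M = 1\<^sub>m M"
    by (rule mat_mult_left_right_inverse[OF _ _ right]) (simp_all add: fourier_mat_def G_def)
qed

text \<open>The eigenvector equations say nothing about multiplicities when some eigenvalues coincide.
  Collected into \<open>C F = F D\<close> with \<open>F\<close> the Fourier matrix and \<open>D\<close> diagonal, they become a
  similarity once \<open>F\<close> is known to be invertible, and \<open>D\<close> shows the multiplicities.\<close>

lemma char_poly_circulant:
  assumes "M > 0"
  shows "char_poly (circulant_mat M c) = (\<Prod>k<M. [:- dft M c k, 1:])"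
proof -
  let ?C = "circulant_mat M c" and ?F = "fourier_mat M"
  define G where "G = mat M M (\<lambda>(k, j). inverse (unity_root M ^ (j * k)) / of_nat M)"
  define D where "D = mat M M (\<lambda>(i, j). if i = j then dft M c i else 0)"
  have carr: "?C \<in> carrier_mat M M" "?F \<in> carrier_mat M M" "G \<in> carrier_mat M M"
      "D \<in> carrier_mat M M"
    by (simp_all add: fourier_mat_def G_def D_def)
  have inv: "?F * G = 1\<^sub>m M" "G * ?F = 1\<^sub>m M"
    using fourier_mat_inverse[OF assms] by (simp_all add: G_def)
  have CF: "?C * ?F = ?F * D"
  proof (rule eq_matI)
    fix i k assume "i < dim_row (?F * D)" "k < dim_col (?F * D)"
    then have ik: "i < M" "k < M" by (simp_all add: fourier_mat_def D_def)
    have "col ?F k = fourier_vec M k"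
      using ik by (intro eq_vecI) (simp_all add: fourier_mat_def fourier_vec_eq)
    then have "(?C * ?F) $$ (i, k) = (?C *\<^sub>v fourier_vec M k) $ i"
      using ik by (simp add: fourier_mat_def)
    also have "\<dots> = dft M c k * unity_root M ^ (i * k)"
      unfolding circulant_mult_fourier_vec using ik by (simp add: fourier_vec_eq)
    also have "\<dots> = (\<Sum>j<M. unity_root M ^ (i * j) * (if j = k then dft M c j else 0))"
      using ik by (simp add: if_distrib[where f = "\<lambda>x. _ * x"] cong: if_cong)
    also have "\<dots> = (?F * D) $$ (i, k)"
      using ik by (simp add: fourier_mat_def D_def scalar_prod_def atLeast0LessThan)
    finally show "(?C * ?F) $$ (i, k) = (?F * D) $$ (i, k)" .
  qed (simp_all add: fourier_mat_def D_def)
  have "?C = ?C * (?F * G)"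
    using carr by (simp add: inv)
  also have "\<dots> = ?C * ?F * G"
    by (rule assoc_mult_mat[OF carr(1-3), symmetric])
  also have "\<dots> = ?F * D * G"
    by (simp add: CF)
  finally have "similar_mat_wit ?C D ?F G"
    using carr inv by (intro similar_mat_witI) simp_all
  then have "similar_mat ?C D"
    by (auto simp: similar_mat_def)
  then have "char_poly ?C = char_poly D"
    by (rule char_poly_similar)
  also have "\<dots> = (\<Prod>a\<leftarrow>diag_mat D. [:- a, 1:])"
    by (rule char_poly_upper_triangular[OF carr(4)]) (auto simp: D_def)
  also have "diag_mat D = map (dft M c) [0..<M]"
    by (simp add: diag_mat_def D_def)
  also have "(\<Prod>a\<leftarrow>map (dft M c) [0..<M]. [:- a, 1:]) = (\<Prod>k<M. [:- dft M c k, 1:])"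
    by (simp add: o_def prod.distinct_set_conv_list[symmetric] atLeast0LessThan)
  finally show ?thesis .
qed

section \<open>The eigenvalues as cosine sums\<close>

lemma unity_root_power_plus_reflect:
  assumes "m \<le> M" "M > 0"
  shows "unity_root M ^ (m * k) + unity_root M ^ ((M - m) * k)
       = complex_of_real (2 * cos (2 * pi * real m * real k / real M))"
proof -
  have "unity_root M ^ (m * k) * unity_root M ^ ((M - m) * k) = (unity_root M ^ M) ^ k"
    using assms by (simp flip: power_add power_mult distrib_right)
  then have "unity_root M ^ (m * k) * unity_root M ^ ((M - m) * k) = 1"
    using assms by (simp add: unity_root_power_M)
  then have "unity_root M ^ ((M - m) * k) = inverse (unity_root M ^ (m * k))"
    by (metis inverse_unique)
  also have "\<dots> = cnj (unity_root M ^ (m * k))"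
    by (simp add: unity_root_power cis_cnj flip: cis_inverse)
  finally show ?thesis
    by (simp add: complex_add_cnj unity_root_power mult.assoc)
qed

text \<open>With \<open>w m = (M - m) / M * \<rho> m\<close> the coefficient \<open>c m\<close> is \<open>w m + w (M - m)\<close>. Moving the
  reflection from \<open>w\<close> to the root of unity leaves \<open>w m\<close> times a sum of two conjugate roots.\<close>

lemma dft_circ_coeff:
  assumes "M > 0"
  shows "dft M (\<lambda>m. complex_of_real (circ_coeff M \<rho> m)) k = complex_of_real (circ_eigval M \<rho> k)"
proof -
  define w where "w m = complex_of_real ((real M - real m) / real M * \<rho> m)" for m
  let ?z = "\<lambda>m. unity_root M ^ (m * k)"
  have split: "{..<M} = insert 0 {1..M - 1}" using assms by auto
  have "dft M (\<lambda>m. complex_of_real (circ_coeff M \<rho> m)) k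
      = complex_of_real (\<rho> 0) + (\<Sum>m = 1..M - 1. complex_of_real (circ_coeff M \<rho> m) * ?z m)"
    unfolding dft_def split by (simp add: circ_coeff_def)
  also have "(\<Sum>m = 1..M - 1. complex_of_real (circ_coeff M \<rho> m) * ?z m)
      = (\<Sum>m = 1..M - 1. w m * ?z m + w (M - m) * ?z m)"
  proof (rule sum.cong[OF refl])
    fix m assume "m \<in> {1..M - 1}"
    then have "m < M" by auto
    then have "complex_of_real (circ_coeff M \<rho> m) = w m + w (M - m)"
      by (simp add: circ_coeff_weighted w_def of_nat_diff)
    then show "complex_of_real (circ_coeff M \<rho> m) * ?z m = w m * ?z m + w (M - m) * ?z m"
      by (simp add: distrib_right)
  qed
  also have "\<dots> = (\<Sum>m = 1..M - 1. w m * ?z m) + (\<Sum>m = 1..M - 1. w (M - m) * ?z m)"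
    by (rule sum.distrib)
  also have "(\<Sum>m = 1..M - 1. w (M - m) * ?z m) = (\<Sum>m = 1..M - 1. w m * ?z (M - m))"
    by (rule sum.reindex_bij_witness[where i = "\<lambda>m. M - m" and j = "\<lambda>m. M - m"]) auto
  also have "(\<Sum>m = 1..M - 1. w m * ?z m) + (\<Sum>m = 1..M - 1. w m * ?z (M - m))
      = (\<Sum>m = 1..M - 1. w m * (?z m + ?z (M - m)))"
    by (simp add: sum.distrib distrib_left)
  also have "\<dots> = (\<Sum>m = 1..M - 1. w m * complex_of_real (2 * cos (2 * pi * real m * real k / real M)))"
    using assms by (intro sum.cong refl arg_cong2[where f = "(*)"] unity_root_power_plus_reflect) auto
  also have "complex_of_real (\<rho> 0) + \<dots> = complex_of_real (circ_eigval M \<rho> k)"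
    by (simp add: circ_eigval_def w_def sum_distrib_left mult_ac)
  finally show ?thesis .
qed

theorem mainTheorem1:
  fixes M :: nat and \<rho> :: "nat \<Rightarrow> real" and \<Sigma> C\<^sub>\<Sigma> :: "real mat"
  assumes "M \<ge> 1"
    and "\<Sigma> = sym_toeplitz_mat M \<rho>"
    and "C\<^sub>\<Sigma> = circulant_mat M (circ_coeff M \<rho>)"
  shows "(\<forall>C. is_arg_min (\<lambda>C. frobenius_norm (\<Sigma> - C)) (is_circulant M) C \<longleftrightarrow> C = C\<^sub>\<Sigma>)
    \<and> (transpose_mat C\<^sub>\<Sigma> = C\<^sub>\<Sigma>)
    \<and> (\<forall>m \<in> {1..M - 1}. circ_coeff M \<rho> m = circ_coeff M \<rho> (M - m))
    \<and> (spectrum (map_mat complex_of_real C\<^sub>\<Sigma>)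
           = (\<lambda>k. complex_of_real (circ_eigval M \<rho> k)) ` {0..M - 1})
    \<and> (char_poly (map_mat complex_of_real C\<^sub>\<Sigma>)
           = (\<Prod>k = 0..M - 1. [:- complex_of_real (circ_eigval M \<rho> k), 1:]))
    \<and> (\<forall>k \<in> {0..M - 1}. eigenvector (map_mat complex_of_real C\<^sub>\<Sigma>)
           (fourier_vec M k) (complex_of_real (circ_eigval M \<rho> k)))"
proof -
  define c where "c m = complex_of_real (circ_coeff M \<rho> m)" for m
  let ?C = "circulant_mat M c" and ?l = "\<lambda>k. complex_of_real (circ_eigval M \<rho> k)"
  have M: "M > 0" and range: "{0..M - 1} = {..<M}"
    using assms(1) by auto
  have C: "map_mat complex_of_real C\<^sub>\<Sigma> = ?C"
    unfolding assms(3) by (rule eq_matI) (simp_all add: c_def)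
  have dft: "dft M c k = ?l k" for k
    unfolding c_def by (rule dft_circ_coeff[OF M])
  have char_poly: "char_poly ?C = (\<Prod>k<M. [:- ?l k, 1:])"
    using char_poly_circulant[OF M, of c] by (simp add: dft)
  have "is_arg_min (\<lambda>C. frobenius_norm (\<Sigma> - C)) (is_circulant M) C \<longleftrightarrow> C = C\<^sub>\<Sigma>" for C
    unfolding assms(2,3)
    by (rule is_arg_min_circulant_iff) (simp_all add: sum_toeplitz_cyclic_diagonal,
        simp add: sym_toeplitz_mat_def)
  moreover have "transpose_mat C\<^sub>\<Sigma> = C\<^sub>\<Sigma>"
    unfolding assms(3) by (rule transpose_circulant_mat) (rule circ_coeff_reflect)
  moreover have "\<forall>m \<in> {1..M - 1}. circ_coeff M \<rho> m = circ_coeff M \<rho> (M - m)"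
    by (intro ballI circ_coeff_reflect) auto
  moreover have "spectrum ?C = ?l ` {..<M}"
  proof -
    have "eigenvalue ?C x \<longleftrightarrow> (\<exists>k<M. x = ?l k)" for x
      by (auto simp: eigenvalue_root_char_poly[OF circulant_mat_carrier] char_poly poly_prod)
    then show ?thesis
      by (auto simp: spectrum_def)
  qed
  moreover have "\<forall>k \<in> {..<M}. eigenvector ?C (fourier_vec M k) (?l k)"
    using eigenvector_circulant[OF M, of c] by (simp add: dft)
  ultimately show ?thesis
    unfolding C range using char_poly by blast
qed

end
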